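(* Let $n\in\mathbb{N}$ ($n\ge 1$) and let $X_1,\ldots,X_n$ be independent mean zero random variables with distributions $G_1\in\mathcal{F}_{\sigma_1},\ldots,G_n\in\mathcal{F}_{\sigma_n}$, where $\sigma_1,\dots,\sigma_n\in(0,\infty)$. Let $F_n$ be the distribution function of $$W=\frac{1}{\sigma}\sum_{i=1}^n X_i,\qquad\text{where } \sigma^2=\sum_{i=1}^n\sigma_i^2,\ \sigma>0.$$ Then $$\|F_n-\Phi\|_1\le \frac{1}{\sigma^3}\sum_{i=1}^n E|X_i|^3 .$$ In particular, if $\sigma\in(0,\infty)$ now denotes the common standard deviation of independent, identically distributed $X_1,X_2,\ldots$ with common distribution $G\in\mathcal{F}_\sigma$, and $F_n$ is the distribution function of $(X_1+\cdots+X_n)/(\sigma\sqrt n)$, then $$\|F_n-\Phi\|_1\le\frac{E|X_1|^3}{\sigma^3\sqrt n}\qquad\text{for all } n\in\mathbb{N}.$$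
   Context: For $\sigma\in(0,\infty)$, $\mathcal{F}_\sigma$ is the collection of probability distributions on $\mathbb{R}$ with mean zero, variance $\sigma^2$ and finite absolute third moment. $\Phi$ is the standard normal distribution function. For distribution functions $F,G$ on $\mathbb{R}$, $\|F-G\|_1=\int_{-\infty}^\infty|F(x)-G(x)|\,dx$. *)

theory Defs
  imports "HOL-Probability.Probability"
begin

(* On a probability measure, integrability of the absolute third power gives integrability
   of the identity and its square, so the two integrals below are genuine moments. *)
definition mean_zero_class :: "real \<Rightarrow> real measure set" where
  "mean_zero_class \<sigma> = {G. real_distribution G
     \<and> integrable G (\<lambda>x. \<bar>x\<bar> ^ 3)
     \<and> prob_space.expectation G (\<lambda>x. x) = 0
     \<and> prob_space.variance G (\<lambda>x. x) = \<sigma>\<^sup>2}"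

(* Valued in ennreal: the Bochner integral would be 0 for a non-integrable difference. *)
definition L1_dist :: "(real \<Rightarrow> real) \<Rightarrow> (real \<Rightarrow> real) \<Rightarrow> ennreal" where
  "L1_dist F G = (\<integral>\<^sup>+ x. ennreal \<bar>F x - G x\<bar> \<partial>lborel)"

end

theory Submission
  imports Defs
begin

text \<open>
  Stein's method. For a \<^term>\<open>K\<close>-Lipschitz function \<^term>\<open>h\<close>, the solution \<^term>\<open>g\<close> of the Stein
  equation \<^term>\<open>g' x - x * g x = h x - m\<close>, with \<^term>\<open>m\<close> the Gaussian mean of \<^term>\<open>h\<close>, has a
  derivative with Lipschitz constant \<^term>\<open>2 * K\<close>. It therefore suffices to bound the expectation of
  \<^term>\<open>g' W - W * g W\<close>, which by independence splits into one term per summand: for a mean zero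
  variable \<^term>\<open>X\<close> with variance \<^term>\<open>v\<close> and any \<^term>\<open>g\<close> with \<^term>\<open>L\<close>-Lipschitz derivative, the
  expectation of \<^term>\<open>v * g' X - X * g X\<close> is at most \<^term>\<open>L / 2\<close> times the third absolute moment
  of \<^term>\<open>X\<close>. This sharp bound replaces the usual zero bias coupling and extreme point argument.
  Write \<^term>\<open>v\<close> as the second moment of an independent copy \<^term>\<open>Y\<close>; after symmetrization and
  after adding \<^term>\<open>X * \<phi> Y + Y * \<phi> X\<close>, which has mean zero, the inequality holds pointwise for a
  suitable \<^term>\<open>\<phi>\<close>. Finally the L1 distance of two distribution functions is the difference of the
  expectations of a single 1-Lipschitz \<^term>\<open>h\<close>, a primitive of the sign of their difference.
\<close>

section \<open>Integrability\<close>

lemma set_integrable_if_integrable: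
  fixes f :: "'a \<Rightarrow> 'b :: {banach, second_countable_topology}"
  assumes "integrable M f" "A \<in> sets M"
  shows "set_integrable M A f"
  using assms unfolding set_integrable_def by (intro integrable_mult_indicator)

lemma borel_measurable_lipschitz:
  fixes h :: "'a :: metric_space \<Rightarrow> 'b :: metric_space"
  assumes "K-lipschitz_on UNIV h"
  shows "h \<in> borel_measurable borel"
  using assms by (intro borel_measurable_continuous_onI lipschitz_on_continuous_on)

lemma (in finite_measure) integrable_lipschitz:
  fixes X :: "'a \<Rightarrow> real" and h :: "real \<Rightarrow> real"
  assumes h: "K-lipschitz_on UNIV h" and X: "integrable M X"
  shows "integrable M (\<lambda>\<omega>. h (X \<omega>))"
proof (rule Bochner_Integration.integrable_bound)
  note [measurable] = borel_measurable_lipschitz[OF h]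
  show "(\<lambda>\<omega>. h (X \<omega>)) \<in> borel_measurable M"
    using X by measurable
  show "integrable M (\<lambda>\<omega>. \<bar>h 0\<bar> + K * \<bar>X \<omega>\<bar>)" using X by simp
  have "\<bar>h x\<bar> \<le> \<bar>h 0\<bar> + K * \<bar>x\<bar>" for x
    using lipschitz_onD[OF h, of x 0] by (simp add: dist_real_def)
  then show "AE \<omega> in M. norm (h (X \<omega>)) \<le> norm (\<bar>h 0\<bar> + K * \<bar>X \<omega>\<bar>)"
    by (auto intro: order_trans[OF _ abs_ge_self])
qed

lemma power_mult_power_le:
  fixes a b :: real
  assumes "0 \<le> a" "0 \<le> b" "i + j \<le> n"
  shows "a ^ i * b ^ j \<le> 1 + a ^ n + b ^ n"
proof -
  define m where "m = max 1 (max a b)"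
  have "a ^ i * b ^ j \<le> m ^ i * m ^ j"
    using assms by (intro mult_mono power_mono) (auto simp: m_def)
  also have "\<dots> = m ^ (i + j)" by (simp add: power_add)
  also have "\<dots> \<le> m ^ n" using assms by (intro power_increasing) (auto simp: m_def)
  also have "\<dots> \<le> 1 + a ^ n + b ^ n" using assms by (auto simp: m_def max_def)
  finally show ?thesis .
qed

lemma (in finite_measure) integrable_power_mult_power:
  fixes X Y :: "'a \<Rightarrow> real"
  assumes [measurable]: "X \<in> borel_measurable M" "Y \<in> borel_measurable M"
    and "integrable M (\<lambda>\<omega>. \<bar>X \<omega>\<bar> ^ n)" "integrable M (\<lambda>\<omega>. \<bar>Y \<omega>\<bar> ^ n)"
    and "i + j \<le> n"
  shows "integrable M (\<lambda>\<omega>. X \<omega> ^ i * Y \<omega> ^ j)"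
proof (rule Bochner_Integration.integrable_bound)
  show "integrable M (\<lambda>\<omega>. 1 + \<bar>X \<omega>\<bar> ^ n + \<bar>Y \<omega>\<bar> ^ n)" using assms by simp
  show "AE \<omega> in M. norm (X \<omega> ^ i * Y \<omega> ^ j) \<le> norm (1 + \<bar>X \<omega>\<bar> ^ n + \<bar>Y \<omega>\<bar> ^ n)"
    using power_mult_power_le[OF abs_ge_zero abs_ge_zero \<open>i + j \<le> n\<close>]
    by (auto simp: abs_mult power_abs)
qed measurable

lemma (in finite_measure) integrable_power_le:
  fixes X :: "'a \<Rightarrow> real"
  assumes "X \<in> borel_measurable M" "integrable M (\<lambda>\<omega>. \<bar>X \<omega>\<bar> ^ n)" "i \<le> n"
  shows "integrable M (\<lambda>\<omega>. X \<omega> ^ i)"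
  using integrable_power_mult_power[of X X n i 0] assms by simp

lemma integrable_abs_add_power:
  fixes X Y :: "'a \<Rightarrow> real"
  assumes [measurable]: "X \<in> borel_measurable M" "Y \<in> borel_measurable M"
    and "integrable M (\<lambda>\<omega>. \<bar>X \<omega>\<bar> ^ n)" "integrable M (\<lambda>\<omega>. \<bar>Y \<omega>\<bar> ^ n)"
  shows "integrable M (\<lambda>\<omega>. \<bar>X \<omega> + Y \<omega>\<bar> ^ n)"
proof (rule Bochner_Integration.integrable_bound)
  show "integrable M (\<lambda>\<omega>. 2 ^ n * (\<bar>X \<omega>\<bar> ^ n + \<bar>Y \<omega>\<bar> ^ n))" using assms by simp
  have "\<bar>x + y\<bar> ^ n \<le> 2 ^ n * (\<bar>x\<bar> ^ n + \<bar>y\<bar> ^ n)" for x y :: real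
  proof -
    have "\<bar>x + y\<bar> ^ n \<le> (2 * max \<bar>x\<bar> \<bar>y\<bar>) ^ n" by (intro power_mono) auto
    also have "\<dots> = 2 ^ n * max \<bar>x\<bar> \<bar>y\<bar> ^ n" by (simp add: power_mult_distrib)
    also have "max \<bar>x\<bar> \<bar>y\<bar> ^ n \<le> \<bar>x\<bar> ^ n + \<bar>y\<bar> ^ n" by (simp add: max_def)
    finally show ?thesis by simp
  qed
  then show "AE \<omega> in M. norm (\<bar>X \<omega> + Y \<omega>\<bar> ^ n) \<le> norm (2 ^ n * (\<bar>X \<omega>\<bar> ^ n + \<bar>Y \<omega>\<bar> ^ n))"
    by auto
qed measurable

lemma (in finite_measure) integrable_abs_sum_power:
  fixes X :: "'i \<Rightarrow> 'a \<Rightarrow> real"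
  assumes "finite I" "\<And>i. i \<in> I \<Longrightarrow> X i \<in> borel_measurable M"
    and "\<And>i. i \<in> I \<Longrightarrow> integrable M (\<lambda>\<omega>. \<bar>X i \<omega>\<bar> ^ n)"
  shows "integrable M (\<lambda>\<omega>. \<bar>\<Sum>i\<in>I. X i \<omega>\<bar> ^ n)"
  using assms
proof (induction I rule: finite_induct)
  case (insert i I)
  then have "integrable M (\<lambda>\<omega>. \<bar>X i \<omega> + (\<Sum>i\<in>I. X i \<omega>)\<bar> ^ n)"
    by (intro integrable_abs_add_power borel_measurable_sum) auto
  then show ?case using insert by simp
qed simp

section \<open>Functions with a Lipschitz derivative\<close>

locale lipschitz_derivative =
  fixes g g' :: "real \<Rightarrow> real" and L :: real
  assumes has_derivative: "(g has_real_derivative g' x) (at x)"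
    and lipschitz: "L-lipschitz_on UNIV g'"
begin

lemma derivative_diff_le: "\<bar>g' x - g' y\<bar> \<le> L * \<bar>x - y\<bar>"
  using lipschitz_onD[OF lipschitz] by (simp add: dist_real_def)

lemma translate: "lipschitz_derivative (\<lambda>x. g (x + c)) (\<lambda>x. g' (x + c)) L"
proof
  show "((\<lambda>x. g (x + c)) has_real_derivative g' (x + c)) (at x)" for x
    using has_derivative[of "x + c"] by (simp add: DERIV_shift)
  show "L-lipschitz_on UNIV (\<lambda>x. g' (x + c))"
    using derivative_diff_le[of "x + c" "y + c" for x y] lipschitz_on_nonneg[OF lipschitz]
    by (auto simp: lipschitz_on_def dist_real_def)
qed

lemma borel_measurable [measurable]:
  "g \<in> borel_measurable borel" "g' \<in> borel_measurable borel"
  using DERIV_isCont[OF has_derivative] borel_measurable_lipschitz[OF lipschitz]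
  by (auto intro!: borel_measurable_continuous_onI continuous_at_imp_continuous_on)

lemma taylor_remainder_le: "\<bar>g y - g x - g' x * (y - x)\<bar> \<le> L / 2 * (y - x)\<^sup>2"
proof -
  define z where "z s = x + s * (y - x)" for s
  define r where "r s = g (z s) - g' x * (s * (y - x))" for s
  have r: "(r has_real_derivative (g' (z s) - g' x) * (y - x)) (at s)" for s
    unfolding r_def z_def
    by (auto intro!: derivative_eq_intros DERIV_chain2[OF has_derivative] simp: algebra_simps)
  have bound: "((\<lambda>s. L / 2 * s\<^sup>2 * (y - x)\<^sup>2) has_real_derivative L * s * (y - x)\<^sup>2) (at s)" for s
    by (auto intro!: derivative_eq_intros)
  have "norm (r 1 - r 0) \<le> L / 2 * 1\<^sup>2 * (y - x)\<^sup>2 - L / 2 * 0\<^sup>2 * (y - x)\<^sup>2"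
  proof (rule differentiable_bound_general[OF zero_less_one])
    fix s :: real
    assume "0 < s"
    then have "\<bar>g' (z s) - g' x\<bar> \<le> L * (s * \<bar>y - x\<bar>)"
      using derivative_diff_le[of "z s" x] by (simp add: z_def abs_mult)
    then have "\<bar>g' (z s) - g' x\<bar> * \<bar>y - x\<bar> \<le> L * (s * \<bar>y - x\<bar>) * \<bar>y - x\<bar>"
      by (intro mult_right_mono) auto
    then show "norm ((g' (z s) - g' x) * (y - x)) \<le> L * s * (y - x)\<^sup>2"
      by (simp add: abs_mult mult.assoc flip: power2_eq_square)
  qed (use r bound in \<open>auto intro!: continuous_at_imp_continuous_on DERIV_isCont
      simp flip: has_real_derivative_iff_has_vector_derivative\<close>)
  then show ?thesis by (simp add: r_def z_def algebra_simps)
qed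

lemma abs_derivative_le_linear: "\<bar>g' x\<bar> \<le> \<bar>g' 0\<bar> + L * \<bar>x\<bar>"
  using derivative_diff_le[of x 0] by simp

lemma abs_le_quadratic: "\<bar>g x\<bar> \<le> \<bar>g 0\<bar> + \<bar>g' 0\<bar> * \<bar>x\<bar> + L / 2 * \<bar>x\<bar> ^ 2"
  using taylor_remainder_le[of x 0] abs_mult[of "g' 0" x] by (simp del: times_divide_eq_left)

text \<open>The left-hand side vanishes for constant \<^term>\<open>g'\<close>. If \<^term>\<open>x\<close> and \<^term>\<open>y\<close> have opposite
  signs, it is the integral of \<^term>\<open>g' y - g' t\<close> over the part of the segment adjacent to \<^term>\<open>y\<close>
  and of length \<^term>\<open>x\<close>, plus a similar integral at \<^term>\<open>x\<close>; so the segment is split at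
  \<^term>\<open>x + y\<close>.\<close>

lemma weighted_secant_le:
  assumes "y \<le> x"
  shows "x * g' y - y * g' x - (g x - g y) \<le> L / 2 * (x * \<bar>x\<bar> - y * \<bar>y\<bar>)"
proof -
  consider (nonneg) "0 \<le> y" | (opposite) "y \<le> 0" "0 \<le> x" | (nonpos) "x \<le> 0" by linarith
  then show ?thesis
  proof cases
    case nonneg
    have "g' y * (x - y) - (g x - g y) \<le> L / 2 * (x - y)\<^sup>2"
      using taylor_remainder_le[of x y] by linarith
    moreover have "y * (g' y - g' x) \<le> y * (L * (x - y))"
      using derivative_diff_le[of y x] assms nonneg by (intro mult_left_mono) auto
    ultimately show ?thesis using assms nonneg by (simp add: field_simps power2_eq_square)
  next
    case opposite
    have "g (x + y) - g x - g' x * y \<le> L / 2 * y\<^sup>2"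
      using abs_le_D1[OF taylor_remainder_le[of "x + y" x]] by simp
    moreover have "- (g (x + y) - g y - g' y * x) \<le> L / 2 * x\<^sup>2"
      using abs_le_D2[OF taylor_remainder_le[of "x + y" y]] by simp
    ultimately show ?thesis using opposite by (simp add: field_simps power2_eq_square)
  next
    case nonpos
    have "g' x * (x - y) - (g x - g y) \<le> L / 2 * (x - y)\<^sup>2"
      using abs_le_D1[OF taylor_remainder_le[of y x]] by (simp add: algebra_simps power2_commute)
    moreover have "- x * (g' x - g' y) \<le> - x * (L * (x - y))"
      using derivative_diff_le[of x y] assms nonpos by (intro mult_left_mono) auto
    ultimately show ?thesis using assms nonpos by (simp add: field_simps power2_eq_square)
  qed
qed

text \<open>The terms with \<^term>\<open>\<phi>\<close> integrate to zero against a mean zero law. Equality on the diagonal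
  \<^term>\<open>x = y\<close> dictates the choice of \<^term>\<open>\<phi>\<close>.\<close>

lemma symmetrized_stein_le:
  fixes \<phi> :: "real \<Rightarrow> real"
  defines "\<phi> \<equiv> \<lambda>x. g x - x * g' x + L / 2 * (x * \<bar>x\<bar>)"
  shows "y\<^sup>2 * g' x + x\<^sup>2 * g' y - x * g x - y * g y + x * \<phi> y + y * \<phi> x
      \<le> L / 2 * (\<bar>x\<bar> ^ 3 + \<bar>y\<bar> ^ 3)"
proof (induction x y rule: linorder_wlog)
  case (sym x y)
  then show ?case by (simp add: algebra_simps)
next
  case (le y x)
  have cube: "\<bar>z\<bar> ^ 3 = z * (z * \<bar>z\<bar>)" for z :: real
    by (simp add: abs_if power3_eq_cube)
  have "(x - y) * (x * g' y - y * g' x - (g x - g y)) \<le> (x - y) * (L / 2 * (x * \<bar>x\<bar> - y * \<bar>y\<bar>))"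
    using le by (intro mult_left_mono weighted_secant_le) auto
  then show ?case
    unfolding \<phi>_def cube by (simp add: field_simps power2_eq_square)
qed

end

section \<open>Stein's bound for sums of independent variables\<close>

lemma (in finite_measure) integrable_mult_lipschitz_derivative:
  fixes X W :: "'a \<Rightarrow> real"
  assumes "lipschitz_derivative g g' L"
    and [measurable]: "X \<in> borel_measurable M" "W \<in> borel_measurable M"
    and cubes: "integrable M (\<lambda>\<omega>. \<bar>X \<omega>\<bar> ^ 3)" "integrable M (\<lambda>\<omega>. \<bar>W \<omega>\<bar> ^ 3)"
  shows "integrable M (\<lambda>\<omega>. X \<omega> * g (W \<omega>))" "integrable M (\<lambda>\<omega>. X \<omega> * g' (W \<omega>))"
proof -
  interpret lipschitz_derivative g g' L by fact
  have product: "integrable M (\<lambda>\<omega>. \<bar>X \<omega>\<bar> * (c * \<bar>W \<omega>\<bar> ^ j))" if "j \<le> 2" for j c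
  proof -
    have "integrable M (\<lambda>\<omega>. \<bar>X \<omega>\<bar> ^ 1 * \<bar>W \<omega>\<bar> ^ j)"
      using cubes that by (intro integrable_power_mult_power[of _ _ 3]) auto
    from integrable_mult_right[OF this, of c] show ?thesis by (simp add: mult_ac)
  qed
  show "integrable M (\<lambda>\<omega>. X \<omega> * g (W \<omega>))"
  proof (rule Bochner_Integration.integrable_bound)
    show "integrable M (\<lambda>\<omega>. \<bar>X \<omega>\<bar> * (\<bar>g 0\<bar> + \<bar>g' 0\<bar> * \<bar>W \<omega>\<bar> + L / 2 * \<bar>W \<omega>\<bar> ^ 2))"
      using product[of 0 "\<bar>g 0\<bar>"] product[of 1 "\<bar>g' 0\<bar>"] product[of 2 "L / 2"]
      by (simp only: distrib_left power_0 power_one_right mult_1_right) simp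
    show "AE \<omega> in M. norm (X \<omega> * g (W \<omega>))
        \<le> norm (\<bar>X \<omega>\<bar> * (\<bar>g 0\<bar> + \<bar>g' 0\<bar> * \<bar>W \<omega>\<bar> + L / 2 * \<bar>W \<omega>\<bar> ^ 2))"
      unfolding norm_mult
      by (intro AE_I2 mult_mono) (auto intro: order_trans[OF abs_le_quadratic abs_ge_self, simplified])
  qed measurable
  show "integrable M (\<lambda>\<omega>. X \<omega> * g' (W \<omega>))"
  proof (rule Bochner_Integration.integrable_bound)
    show "integrable M (\<lambda>\<omega>. \<bar>X \<omega>\<bar> * (\<bar>g' 0\<bar> + L * \<bar>W \<omega>\<bar>))"
      using product[of 0 "\<bar>g' 0\<bar>"] product[of 1 L] by (simp add: distrib_left)
    show "AE \<omega> in M. norm (X \<omega> * g' (W \<omega>)) \<le> norm (\<bar>X \<omega>\<bar> * (\<bar>g' 0\<bar> + L * \<bar>W \<omega>\<bar>))"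
      unfolding norm_mult
      by (intro AE_I2 mult_mono) (auto intro: order_trans[OF abs_derivative_le_linear abs_ge_self])
  qed measurable
qed

lemma (in finite_measure) integrable_lipschitz_derivative:
  fixes W :: "'a \<Rightarrow> real"
  assumes "lipschitz_derivative g g' L"
    and "W \<in> borel_measurable M" "integrable M (\<lambda>\<omega>. \<bar>W \<omega>\<bar> ^ 3)"
  shows "integrable M (\<lambda>\<omega>. g (W \<omega>))" "integrable M (\<lambda>\<omega>. g' (W \<omega>))"
  using integrable_mult_lipschitz_derivative[OF assms(1), of "\<lambda>_. 1" W] assms by auto

lemma (in prob_space) stein_bound:
  fixes X :: "'a \<Rightarrow> real"
  assumes "lipschitz_derivative g g' L"
    and X [measurable]: "X \<in> borel_measurable M"
    and cube: "integrable M (\<lambda>\<omega>. \<bar>X \<omega>\<bar> ^ 3)" and mean: "expectation X = 0"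
  shows "expectation (\<lambda>\<omega>. (X \<omega>)\<^sup>2) * expectation (\<lambda>\<omega>. g' (X \<omega>)) - expectation (\<lambda>\<omega>. X \<omega> * g (X \<omega>))
    \<le> L / 2 * expectation (\<lambda>\<omega>. \<bar>X \<omega>\<bar> ^ 3)"
proof -
  interpret lipschitz_derivative g g' L by fact
  define \<phi> where "\<phi> x = g x - x * g' x + L / 2 * (x * \<bar>x\<bar>)" for x
  note [simp] = integrable_lipschitz_derivative[OF assms(1) X cube]
    integrable_mult_lipschitz_derivative[OF assms(1) X X cube cube]
  have [simp]: "integrable M X" "integrable M (\<lambda>\<omega>. (X \<omega>)\<^sup>2)"
    using integrable_power_le[OF X cube, of 1] integrable_power_le[OF X cube, of 2] by auto
  have "integrable M (\<lambda>\<omega>. X \<omega> * \<bar>X \<omega>\<bar>)"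
    using integrable_power_mult_power[of X "\<lambda>\<omega>. \<bar>X \<omega>\<bar>" 3 1 1] cube by simp
  then have [simp]: "integrable M (\<lambda>\<omega>. \<phi> (X \<omega>))" by (simp add: \<phi>_def)
  have integrated: "y\<^sup>2 * expectation (\<lambda>\<omega>. g' (X \<omega>)) + expectation (\<lambda>\<omega>. (X \<omega>)\<^sup>2) * g' y
        - expectation (\<lambda>\<omega>. X \<omega> * g (X \<omega>)) - y * g y + y * expectation (\<lambda>\<omega>. \<phi> (X \<omega>))
      \<le> L / 2 * (expectation (\<lambda>\<omega>. \<bar>X \<omega>\<bar> ^ 3) + \<bar>y\<bar> ^ 3)" for y
  proof -
    have "expectation (\<lambda>\<omega>. y\<^sup>2 * g' (X \<omega>) + (X \<omega>)\<^sup>2 * g' y - X \<omega> * g (X \<omega>) - y * g y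
          + X \<omega> * \<phi> y + y * \<phi> (X \<omega>))
        \<le> expectation (\<lambda>\<omega>. L / 2 * (\<bar>X \<omega>\<bar> ^ 3 + \<bar>y\<bar> ^ 3))"
      by (intro integral_mono symmetrized_stein_le[folded \<phi>_def]) (simp_all add: cube)
    then show ?thesis using cube mean by (simp add: prob_space)
  qed
  have "expectation (\<lambda>\<omega>. (X \<omega>)\<^sup>2 * expectation (\<lambda>\<omega>. g' (X \<omega>)) + expectation (\<lambda>\<omega>. (X \<omega>)\<^sup>2) * g' (X \<omega>)
        - expectation (\<lambda>\<omega>. X \<omega> * g (X \<omega>)) - X \<omega> * g (X \<omega>) + X \<omega> * expectation (\<lambda>\<omega>. \<phi> (X \<omega>)))
      \<le> expectation (\<lambda>\<omega>. L / 2 * (expectation (\<lambda>\<omega>. \<bar>X \<omega>\<bar> ^ 3) + \<bar>X \<omega>\<bar> ^ 3))"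
    by (intro integral_mono integrated) (simp_all add: cube)
  then show ?thesis using cube mean by (simp add: prob_space mult.commute)
qed

lemma (in prob_space) expectation_le_if_indep_var:
  fixes f :: "'b \<Rightarrow> 'b \<Rightarrow> real"
  assumes indep: "indep_var S X T Y"
    and [measurable]: "case_prod f \<in> borel_measurable (S \<Otimes>\<^sub>M T)"
    and integrable: "integrable M (\<lambda>\<omega>. f (X \<omega>) (Y \<omega>))"
    and le: "\<And>y. y \<in> space T \<Longrightarrow> expectation (\<lambda>\<omega>. f (X \<omega>) y) \<le> C"
  shows "expectation (\<lambda>\<omega>. f (X \<omega>) (Y \<omega>)) \<le> C"
proof -
  note [measurable] = indep_var_rv1[OF indep] indep_var_rv2[OF indep]
  interpret X: prob_space "distr M S X" by (rule prob_space_distr) measurable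
  interpret Y: prob_space "distr M T Y" by (rule prob_space_distr) measurable
  interpret XY: pair_prob_space "distr M S X" "distr M T Y" ..
  have joint: "distr M S X \<Otimes>\<^sub>M distr M T Y = distr M (S \<Otimes>\<^sub>M T) (\<lambda>\<omega>. (X \<omega>, Y \<omega>))"
    using indep by (simp add: indep_var_distribution_eq)
  have joint_integrable: "integrable (distr M S X \<Otimes>\<^sub>M distr M T Y) (case_prod f)"
    unfolding joint using integrable by (simp add: integrable_distr_eq)
  have "expectation (\<lambda>\<omega>. f (X \<omega>) (Y \<omega>)) = (\<integral>z. case_prod f z \<partial>(distr M S X \<Otimes>\<^sub>M distr M T Y))"
    unfolding joint by (simp add: integral_distr)
  also have "\<dots> = (\<integral>y. (\<integral>x. f x y \<partial>distr M S X) \<partial>distr M T Y)"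
    using XY.integral_snd[of f] joint_integrable by simp
  also have "\<dots> \<le> (\<integral>y. C \<partial>distr M T Y)"
    using XY.integrable_snd[of f] joint_integrable le
    by (intro integral_mono) (auto simp: integral_distr)
  also have "\<dots> = C" using Y.prob_space by simp
  finally show ?thesis .
qed

lemma (in prob_space) stein_bound_add_indep:
  fixes X S :: "'a \<Rightarrow> real"
  assumes g: "lipschitz_derivative g g' L" and indep: "indep_var borel X borel S"
    and cubes: "integrable M (\<lambda>\<omega>. \<bar>X \<omega>\<bar> ^ 3)" "integrable M (\<lambda>\<omega>. \<bar>S \<omega>\<bar> ^ 3)"
    and mean: "expectation X = 0"
  shows "expectation (\<lambda>\<omega>. (X \<omega>)\<^sup>2) * expectation (\<lambda>\<omega>. g' (X \<omega> + S \<omega>))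
      - expectation (\<lambda>\<omega>. X \<omega> * g (X \<omega> + S \<omega>))
    \<le> L / 2 * expectation (\<lambda>\<omega>. \<bar>X \<omega>\<bar> ^ 3)"
proof -
  interpret lipschitz_derivative g g' L by fact
  note [measurable] = indep_var_rv1[OF indep] indep_var_rv2[OF indep]
  define v where "v = expectation (\<lambda>\<omega>. (X \<omega>)\<^sup>2)"
  have sum_integrable: "integrable M (\<lambda>\<omega>. g' (X \<omega> + T \<omega>))"
      "integrable M (\<lambda>\<omega>. X \<omega> * g (X \<omega> + T \<omega>))"
    if [measurable]: "T \<in> borel_measurable M" and "integrable M (\<lambda>\<omega>. \<bar>T \<omega>\<bar> ^ 3)" for T
  proof -
    have "integrable M (\<lambda>\<omega>. \<bar>X \<omega> + T \<omega>\<bar> ^ 3)"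
      using that cubes(1) by (intro integrable_abs_add_power) auto
    then show "integrable M (\<lambda>\<omega>. g' (X \<omega> + T \<omega>))" "integrable M (\<lambda>\<omega>. X \<omega> * g (X \<omega> + T \<omega>))"
      using integrable_lipschitz_derivative(2)[OF g]
        integrable_mult_lipschitz_derivative(1)[OF g _ _ cubes(1)] by simp_all
  qed
  have "expectation (\<lambda>\<omega>. v * g' (X \<omega> + S \<omega>) - X \<omega> * g (X \<omega> + S \<omega>))
      \<le> L / 2 * expectation (\<lambda>\<omega>. \<bar>X \<omega>\<bar> ^ 3)"
  proof (rule expectation_le_if_indep_var[OF indep])
    show "expectation (\<lambda>\<omega>. v * g' (X \<omega> + s) - X \<omega> * g (X \<omega> + s))
        \<le> L / 2 * expectation (\<lambda>\<omega>. \<bar>X \<omega>\<bar> ^ 3)" for s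
      using stein_bound[OF translate _ cubes(1) mean] sum_integrable[of "\<lambda>_. s"]
      by (simp add: v_def)
  qed (use sum_integrable[of S] cubes in auto)
  then show ?thesis using sum_integrable[of S] cubes by (simp add: v_def)
qed

lemma (in prob_space) indep_vars_rv:
  assumes "indep_vars N X I" "i \<in> I"
  shows "X i \<in> measurable M (N i)"
  using assms by (simp add: indep_vars_def)

lemma (in prob_space) stein_bound_sum:
  fixes X :: "'i \<Rightarrow> 'a \<Rightarrow> real"
  assumes g: "lipschitz_derivative g g' L"
    and I: "finite I" and indep: "indep_vars (\<lambda>_. borel) X I"
    and cubes: "\<And>i. i \<in> I \<Longrightarrow> integrable M (\<lambda>\<omega>. \<bar>X i \<omega>\<bar> ^ 3)"
    and mean: "\<And>i. i \<in> I \<Longrightarrow> expectation (X i) = 0"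
  defines "W \<equiv> \<lambda>\<omega>. \<Sum>i\<in>I. X i \<omega>"
  shows "(\<Sum>i\<in>I. expectation (\<lambda>\<omega>. (X i \<omega>)\<^sup>2)) * expectation (\<lambda>\<omega>. g' (W \<omega>))
      - expectation (\<lambda>\<omega>. W \<omega> * g (W \<omega>))
    \<le> L / 2 * (\<Sum>i\<in>I. expectation (\<lambda>\<omega>. \<bar>X i \<omega>\<bar> ^ 3))"
proof -
  note rv = indep_vars_rv[OF indep]
  have W_cube: "integrable M (\<lambda>\<omega>. \<bar>W \<omega>\<bar> ^ 3)"
    unfolding W_def using I cubes by (intro integrable_abs_sum_power rv)
  have summand: "expectation (\<lambda>\<omega>. (X i \<omega>)\<^sup>2) * expectation (\<lambda>\<omega>. g' (W \<omega>))
      - expectation (\<lambda>\<omega>. X i \<omega> * g (W \<omega>)) \<le> L / 2 * expectation (\<lambda>\<omega>. \<bar>X i \<omega>\<bar> ^ 3)" if "i \<in> I" for i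
  proof -
    have "W \<omega> = X i \<omega> + (\<Sum>j\<in>I - {i}. X j \<omega>)" for \<omega>
      unfolding W_def using I that by (simp add: sum.remove)
    moreover have "indep_var borel (X i) borel (\<lambda>\<omega>. \<Sum>j\<in>I - {i}. X j \<omega>)"
      using that I indep by (intro indep_vars_sum) (auto simp: insert_absorb)
    moreover have "integrable M (\<lambda>\<omega>. \<bar>\<Sum>j\<in>I - {i}. X j \<omega>\<bar> ^ 3)"
      using I cubes by (intro integrable_abs_sum_power rv) auto
    ultimately show ?thesis
      using stein_bound_add_indep[OF g] cubes mean that by presburger
  qed
  have "expectation (\<lambda>\<omega>. W \<omega> * g (W \<omega>)) = expectation (\<lambda>\<omega>. \<Sum>i\<in>I. X i \<omega> * g (W \<omega>))"
    by (subst (1) W_def) (simp add: sum_distrib_right)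
  also have "\<dots> = (\<Sum>i\<in>I. expectation (\<lambda>\<omega>. X i \<omega> * g (W \<omega>)))"
    using cubes W_cube rv unfolding W_def
    by (intro Bochner_Integration.integral_sum borel_measurable_sum
        integrable_mult_lipschitz_derivative(1)[OF g])
  finally have "(\<Sum>i\<in>I. expectation (\<lambda>\<omega>. (X i \<omega>)\<^sup>2)) * expectation (\<lambda>\<omega>. g' (W \<omega>))
        - expectation (\<lambda>\<omega>. W \<omega> * g (W \<omega>))
      = (\<Sum>i\<in>I. expectation (\<lambda>\<omega>. (X i \<omega>)\<^sup>2) * expectation (\<lambda>\<omega>. g' (W \<omega>))
        - expectation (\<lambda>\<omega>. X i \<omega> * g (W \<omega>)))"
    by (simp add: sum_subtractf sum_distrib_right)
  also have "\<dots> \<le> (\<Sum>i\<in>I. L / 2 * expectation (\<lambda>\<omega>. \<bar>X i \<omega>\<bar> ^ 3))"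
    using summand by (rule sum_mono)
  finally show ?thesis by (simp add: sum_distrib_left)
qed

section \<open>Partial moments of the normal distribution\<close>

lemma set_integral_atMost_add_greaterThan:
  fixes p :: "real \<Rightarrow> real"
  assumes "sets M = sets borel" "integrable M p"
  shows "(LINT x:{..w}|M. p x) + (LINT x:{w<..}|M. p x) = (LINT x|M. p x)"
proof -
  have "(LINT x:{..w} \<union> {w<..}|M. p x) = (LINT x:{..w}|M. p x) + (LINT x:{w<..}|M. p x)"
    using assms by (intro set_integral_Un set_integrable_if_integrable) auto
  moreover have "{..w} \<union> {w<..} = UNIV" by auto
  ultimately show ?thesis by (simp add: set_lebesgue_integral_def)
qed

lemma interval_integral_Iic:
  fixes p :: "real \<Rightarrow> real"
  shows "(LBINT x=-\<infinity>..ereal w. p x) = (LBINT x:{..w}. p x)"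
  unfolding interval_lebesgue_integral_def einterval_eq_Iic
  by (simp, rule set_integral_discrete_difference[of "{w}"]) auto

lemma lborel_integral_atMost_has_real_derivative:
  fixes p :: "real \<Rightarrow> real"
  assumes cont: "continuous_on UNIV p" and p: "integrable lborel p"
  shows "((\<lambda>u. LBINT x:{..u}. p x) has_real_derivative p w) (at w)"
proof -
  have "set_integrable lborel A p" if "A \<in> sets borel" for A
    using p that by (intro set_integrable_if_integrable) auto
  then have split: "(LBINT x=-\<infinity>..u. p x)
      = (LBINT x=-\<infinity>..ereal (w - 1). p x) + (LBINT x=w - 1..u. p x)" for u :: real
    by (intro interval_integral_sum[symmetric]) (auto simp: interval_lebesgue_integrable_def)
  have "((\<lambda>u. LBINT x=w - 1..u. p x) has_vector_derivative p w) (at w within {w - 1..w + 1})"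
    using cont by (intro interval_integral_FTC2) (auto intro: continuous_on_subset)
  then have "((\<lambda>u. LBINT x=w - 1..u. p x) has_real_derivative p w) (at w)"
    by (simp add: at_within_Icc_at has_real_derivative_iff_has_vector_derivative)
  then have "((\<lambda>u. (LBINT x=-\<infinity>..ereal (w - 1). p x) + (LBINT x=w - 1..u. p x))
      has_real_derivative p w) (at w)"
    by (rule DERIV_cong[OF DERIV_add[OF DERIV_const]]) simp
  then show ?thesis unfolding split[symmetric] unfolding interval_integral_Iic .
qed

lemma lborel_integral_atMost_FTC:
  fixes p :: "real \<Rightarrow> real"
  assumes F: "\<And>x. (F has_real_derivative p x) (at x)" and lim: "(F \<longlongrightarrow> 0) at_bot"
    and cont: "continuous_on UNIV p" and p: "integrable lborel p"
  shows "(LBINT x:{..w}. p x) = F w"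
proof -
  have "(LBINT x=-\<infinity>..ereal w. p x) = F w - 0"
  proof (rule interval_integral_FTC_integrable)
    show "(F has_vector_derivative p x) (at x)" for x
      using F by (simp add: has_real_derivative_iff_has_vector_derivative)
    show "set_integrable lborel (einterval (- \<infinity>) (ereal w)) p"
      using p by (intro set_integrable_if_integrable) auto
    show "((F \<circ> real_of_ereal) \<longlongrightarrow> 0) (at_right (- \<infinity>))"
      using lim by (simp add: ereal_tendsto_simps)
    show "((F \<circ> real_of_ereal) \<longlongrightarrow> F w) (at_left (ereal w))"
      using DERIV_isCont[OF F] by (simp add: ereal_tendsto_simps isCont_def filterlim_at_split)
  qed (use cont in \<open>auto simp: continuous_on_eq_continuous_at\<close>)
  then show ?thesis by (simp add: interval_integral_Iic)
qed

lemma std_normal_density_has_real_derivative: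
  "(std_normal_density has_real_derivative - x * std_normal_density x) (at x)"
  unfolding std_normal_density_def by (auto intro!: derivative_eq_intros simp: field_simps)

lemma continuous_on_std_normal_density [continuous_intros]:
  "continuous_on S std_normal_density"
  using DERIV_isCont[OF std_normal_density_has_real_derivative]
  by (simp add: continuous_at_imp_continuous_on)

interpretation std_normal: real_distribution std_normal_distribution
  by (rule real_dist_normal_dist)

lemma integrable_std_normal_distribution_ident [simp]:
  "integrable std_normal_distribution (\<lambda>x. x)"
  using integrable_std_normal_distribution_moment[of 1] by simp

lemma set_integral_std_normal_distribution:
  fixes f :: "real \<Rightarrow> real"
  assumes "A \<in> sets borel" "f \<in> borel_measurable borel"
  shows "(LINT x:A|std_normal_distribution. f x) = (LBINT x:A. std_normal_density x * f x)"
  using assms unfolding set_lebesgue_integral_def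
  by (subst integral_density) (auto intro!: Bochner_Integration.integral_cong)

lemma set_integral_std_normal_atMost:
  "(LINT x:{..w}|std_normal_distribution. c) = c * cdf std_normal_distribution w"
  "(LINT x:{..w}|std_normal_distribution. x) = - std_normal_density w"
  "(LINT x:{..w}|std_normal_distribution. x\<^sup>2)
    = cdf std_normal_distribution w - w * std_normal_density w"
proof -
  let ?\<phi> = std_normal_density
  show const: "(LINT x:{..w}|std_normal_distribution. c) = c * cdf std_normal_distribution w" for c
    by (simp add: set_lebesgue_integral_def cdf_def)
  have "(LBINT x:{..w}. ?\<phi> x * x) = - ?\<phi> w"
  proof (rule lborel_integral_atMost_FTC)
    show "((\<lambda>x. - ?\<phi> x) has_real_derivative ?\<phi> x * x) (at x)" for x
      by (auto intro!: derivative_eq_intros std_normal_density_has_real_derivative)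
    show "((\<lambda>x. - ?\<phi> x) \<longlongrightarrow> 0) at_bot" unfolding std_normal_density_def by real_asymp
  qed (use integrable_std_normal_moment[of 1] in \<open>auto intro!: continuous_intros\<close>)
  then show "(LINT x:{..w}|std_normal_distribution. x) = - ?\<phi> w"
    by (simp add: set_integral_std_normal_distribution)
  have "(LBINT x:{..w}. ?\<phi> x * (x\<^sup>2 - 1)) = - (w * ?\<phi> w)"
  proof (rule lborel_integral_atMost_FTC)
    show "((\<lambda>x. - (x * ?\<phi> x)) has_real_derivative ?\<phi> x * (x\<^sup>2 - 1)) (at x)" for x
      by (auto intro!: derivative_eq_intros std_normal_density_has_real_derivative
          simp: algebra_simps power2_eq_square)
    show "((\<lambda>x. - (x * ?\<phi> x)) \<longlongrightarrow> 0) at_bot" unfolding std_normal_density_def by real_asymp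
    show "integrable lborel (\<lambda>x. ?\<phi> x * (x\<^sup>2 - 1))"
      using integrable_std_normal_moment[of 2] integrable_std_normal_moment[of 0]
      by (simp add: right_diff_distrib)
  qed (auto intro!: continuous_intros)
  then have "(LINT x:{..w}|std_normal_distribution. x\<^sup>2 - 1) = - (w * ?\<phi> w)"
    by (simp add: set_integral_std_normal_distribution)
  moreover have "(LINT x:{..w}|std_normal_distribution. x\<^sup>2 - 1)
      = (LINT x:{..w}|std_normal_distribution. x\<^sup>2) - (LINT x:{..w}|std_normal_distribution. 1)"
    using integrable_std_normal_distribution_moment
    by (intro set_integral_diff set_integrable_if_integrable) auto
  ultimately show "(LINT x:{..w}|std_normal_distribution. x\<^sup>2)
      = cdf std_normal_distribution w - w * ?\<phi> w"
    by (simp add: const)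
qed

lemma set_integral_std_normal_greaterThan:
  "(LINT x:{w<..}|std_normal_distribution. c) = c * (1 - cdf std_normal_distribution w)"
  "(LINT x:{w<..}|std_normal_distribution. x) = std_normal_density w"
  "(LINT x:{w<..}|std_normal_distribution. x\<^sup>2)
    = 1 - cdf std_normal_distribution w + w * std_normal_density w"
proof -
  note split = set_integral_atMost_add_greaterThan[of std_normal_distribution _ w,
      OF std_normal.events_eq_borel integrable_std_normal_distribution_moment]
  show "(LINT x:{w<..}|std_normal_distribution. c) = c * (1 - cdf std_normal_distribution w)"
    using set_integral_atMost_add_greaterThan[of std_normal_distribution "\<lambda>_. c" w]
      set_integral_std_normal_atMost(1)[of w c] std_normal.prob_space
    by (simp add: right_diff_distrib)
  show "(LINT x:{w<..}|std_normal_distribution. x) = std_normal_density w"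
    using split[of 1] set_integral_std_normal_atMost(2)[of w]
      integral_std_normal_distribution_moment_odd[of 1] by simp
  show "(LINT x:{w<..}|std_normal_distribution. x\<^sup>2)
    = 1 - cdf std_normal_distribution w + w * std_normal_density w"
    using split[of 2] set_integral_std_normal_atMost(3)[of w]
      std_normal_distribution_even_moments(1)[of 1] by simp
qed

lemma set_integrable_std_normal_distribution [simp]:
  assumes "A \<in> sets borel"
  shows "set_integrable std_normal_distribution A (\<lambda>x. c :: real)"
    "set_integrable std_normal_distribution A (\<lambda>x. x)"
    "set_integrable std_normal_distribution A (\<lambda>x. x\<^sup>2)"
  using assms integrable_std_normal_distribution_moment[of 2]
  by (simp_all add: set_integrable_if_integrable)

lemma set_integral_std_normal_distance:
  "(LINT x:{..w}|std_normal_distribution. \<bar>x - w\<bar>)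
    = w * cdf std_normal_distribution w + std_normal_density w"
  "(LINT x:{w<..}|std_normal_distribution. \<bar>x - w\<bar>)
    = std_normal_density w - w * (1 - cdf std_normal_distribution w)"
proof -
  have "(LINT x:{..w}|std_normal_distribution. \<bar>x - w\<bar>)
      = (LINT x:{..w}|std_normal_distribution. w - x)"
    by (intro set_lebesgue_integral_cong) auto
  then show "(LINT x:{..w}|std_normal_distribution. \<bar>x - w\<bar>)
      = w * cdf std_normal_distribution w + std_normal_density w"
    by (simp add: set_integral_std_normal_atMost)
  have "(LINT x:{w<..}|std_normal_distribution. \<bar>x - w\<bar>)
      = (LINT x:{w<..}|std_normal_distribution. x - w)"
    by (intro set_lebesgue_integral_cong) auto
  then show "(LINT x:{w<..}|std_normal_distribution. \<bar>x - w\<bar>)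
      = std_normal_density w - w * (1 - cdf std_normal_distribution w)"
    by (simp add: set_integral_std_normal_greaterThan)
qed

lemma set_integral_std_normal_square_distance:
  "(LINT x:{..w}|std_normal_distribution. (x - w)\<^sup>2)
    = (1 + w\<^sup>2) * cdf std_normal_distribution w + w * std_normal_density w"
  "(LINT x:{w<..}|std_normal_distribution. (x - w)\<^sup>2)
    = (1 + w\<^sup>2) * (1 - cdf std_normal_distribution w) - w * std_normal_density w"
  by (simp_all add: power2_diff set_integral_std_normal_atMost set_integral_std_normal_greaterThan)
    (simp_all add: algebra_simps power2_eq_square)

section \<open>The Stein equation\<close>

definition stein_solution :: "(real \<Rightarrow> real) \<Rightarrow> real \<Rightarrow> real" where
  "stein_solution h w
    = (LINT x:{..w}|std_normal_distribution. h x - std_normal.expectation h) / std_normal_density w"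

lemma stein_solution_has_real_derivative:
  assumes h: "K-lipschitz_on UNIV h"
  shows "(stein_solution h has_real_derivative
    w * stein_solution h w + (h w - std_normal.expectation h)) (at w)"
proof -
  define p where "p x = std_normal_density x * (h x - std_normal.expectation h)" for x
  note [measurable] = borel_measurable_lipschitz[OF h]
  have solution: "stein_solution h = (\<lambda>w. (LBINT x:{..w}. p x) / std_normal_density w)"
    unfolding stein_solution_def p_def by (subst set_integral_std_normal_distribution) auto
  have "integrable std_normal_distribution (\<lambda>x. h x - std_normal.expectation h)"
    using std_normal.integrable_lipschitz[OF h] by simp
  then have "integrable lborel p"
    unfolding p_def by (subst (asm) integrable_density) auto
  moreover have "continuous_on UNIV p"
    unfolding p_def by (intro continuous_intros lipschitz_on_continuous_on[OF h])
  ultimately have integral: "((\<lambda>w. LBINT x:{..w}. p x) has_real_derivative p w) (at w)"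
    by (intro lborel_integral_atMost_has_real_derivative)
  have pos: "std_normal_density w \<noteq> 0"
    using normal_density_pos[of 1 0 w] by simp
  have "(stein_solution h has_real_derivative
      (p w * std_normal_density w - (LBINT x:{..w}. p x) * (- w * std_normal_density w))
        / (std_normal_density w * std_normal_density w)) (at w)"
    unfolding solution
    by (rule DERIV_divide[OF integral std_normal_density_has_real_derivative pos])
  then show ?thesis
    by (rule DERIV_cong) (use pos in \<open>simp add: solution p_def[of w] field_simps\<close>)
qed

lemma (in finite_measure) set_integral_lipschitz_diff_le:
  fixes X :: "'a \<Rightarrow> real" and h :: "real \<Rightarrow> real"
  assumes h: "K-lipschitz_on UNIV h" and X: "integrable M X" and A: "A \<in> sets M"
  shows "\<bar>LINT \<omega>:A|M. h (X \<omega>) - h w\<bar> \<le> K * (LINT \<omega>:A|M. \<bar>X \<omega> - w\<bar>)"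
proof -
  have diff: "set_integrable M A (\<lambda>\<omega>. h (X \<omega>) - h w)"
    using integrable_lipschitz[OF h X] A by (intro set_integrable_if_integrable) auto
  have "\<bar>LINT \<omega>:A|M. h (X \<omega>) - h w\<bar> \<le> (LINT \<omega>:A|M. \<bar>h (X \<omega>) - h w\<bar>)"
    using set_integral_norm_bound[OF diff] by simp
  also have "\<dots> \<le> (LINT \<omega>:A|M. K * \<bar>X \<omega> - w\<bar>)"
    using lipschitz_onD[OF h] X A
    by (intro set_integral_mono set_integrable_abs diff set_integrable_if_integrable)
      (auto simp: dist_real_def)
  finally show ?thesis by simp
qed

text \<open>The square distances are nonnegative weights, so the bound below follows from the worst case
  \<^term>\<open>\<bar>h x - h w\<bar> = K * \<bar>x - w\<bar>\<close>.\<close>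

lemma stein_solution_decomposition:
  assumes h: "K-lipschitz_on UNIV h"
  shows "std_normal_density w
      * ((1 + w\<^sup>2) * stein_solution h w + w * (h w - std_normal.expectation h))
    = (LINT x:{w<..}|std_normal_distribution. (x - w)\<^sup>2)
        * (LINT x:{..w}|std_normal_distribution. h x - h w)
      - (LINT x:{..w}|std_normal_distribution. (x - w)\<^sup>2)
        * (LINT x:{w<..}|std_normal_distribution. h x - h w)"
    (is "_ = _ * ?a - _ * ?b")
proof -
  define m where "m = std_normal.expectation h"
  have [simp]: "integrable std_normal_distribution h"
    using std_normal.integrable_lipschitz[OF h] by simp
  have mean: "m = h w + ?a + ?b"
  proof -
    have "?a + ?b = std_normal.expectation (\<lambda>x. h x - h w)"
      by (intro set_integral_atMost_add_greaterThan) auto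
    then show ?thesis using std_normal.prob_space by (simp add: m_def)
  qed
  have "(LINT x:{..w}|std_normal_distribution. h x - m)
      = (LINT x:{..w}|std_normal_distribution. (h x - h w) + (h w - m))" by simp
  also have "\<dots> = ?a + (h w - m) * cdf std_normal_distribution w"
    by (subst set_integral_add(2))
      (auto intro!: set_integrable_if_integrable simp: set_integral_std_normal_atMost(1))
  finally have "std_normal_density w * stein_solution h w
      = ?a + (h w - m) * cdf std_normal_distribution w"
    using normal_density_pos[of 1 0 w] by (simp add: stein_solution_def m_def)
  then have "std_normal_density w * ((1 + w\<^sup>2) * stein_solution h w + w * (h w - m))
      = (1 + w\<^sup>2) * (?a + (h w - m) * cdf std_normal_distribution w)
        + std_normal_density w * (w * (h w - m))"
    by (simp only: distrib_left mult.left_commute[of "std_normal_density w" "1 + w\<^sup>2"])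
  then show ?thesis
    unfolding set_integral_std_normal_square_distance m_def[symmetric] mean
    by (simp add: algebra_simps)
qed

lemma stein_solution_bound:
  assumes h: "K-lipschitz_on UNIV h"
  shows "\<bar>(1 + w\<^sup>2) * stein_solution h w + w * (h w - std_normal.expectation h)\<bar> \<le> K"
    (is "\<bar>?q\<bar> \<le> K")
proof -
  let ?\<phi> = std_normal_density and ?dist = "\<lambda>A. LINT x:A|std_normal_distribution. \<bar>x - w\<bar>"
    and ?square = "\<lambda>A. LINT x:A|std_normal_distribution. (x - w)\<^sup>2"
    and ?diff = "\<lambda>A. LINT x:A|std_normal_distribution. h x - h w"
  have pos: "0 < ?\<phi> w" by (simp add: normal_density_pos)
  have square: "0 \<le> ?square A" for A
    unfolding set_lebesgue_integral_def by (intro Bochner_Integration.integral_nonneg) auto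
  have diff: "\<bar>?diff A\<bar> \<le> K * ?dist A" if "A \<in> sets borel" for A
    using that by (intro std_normal.set_integral_lipschitz_diff_le h) auto
  have "\<bar>?\<phi> w * ?q\<bar> \<le> ?square {w<..} * \<bar>?diff {..w}\<bar> + ?square {..w} * \<bar>?diff {w<..}\<bar>"
    unfolding stein_solution_decomposition[OF h]
    using square by (intro order_trans[OF abs_triangle_ineq4]) (simp add: abs_mult)
  also have "\<dots> \<le> ?square {w<..} * (K * ?dist {..w}) + ?square {..w} * (K * ?dist {w<..})"
    by (intro add_mono mult_left_mono diff square) auto
  also have "\<dots> = ?\<phi> w * K"
    unfolding set_integral_std_normal_square_distance set_integral_std_normal_distance
    by (simp add: algebra_simps power2_eq_square)
  finally show ?thesis using pos by (simp add: abs_mult)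
qed

lemma stein_solution_lipschitz_derivative:
  assumes h: "K-lipschitz_on UNIV h"
  shows "lipschitz_derivative (stein_solution h)
    (\<lambda>w. w * stein_solution h w + (h w - std_normal.expectation h)) (2 * K)"
proof
  let ?m = "std_normal.expectation h"
  show "(stein_solution h has_real_derivative w * stein_solution h w + (h w - ?m)) (at w)" for w
    by (rule stein_solution_has_real_derivative[OF h])
  \<comment> \<open>The derivative of the solution need not be differentiable, but its first summand is.\<close>
  have "K-lipschitz_on UNIV (\<lambda>w. w * stein_solution h w)"
  proof (rule lipschitz_onI)
    fix x y :: real
    have "norm (x * stein_solution h x - y * stein_solution h y) \<le> K * norm (x - y)"
    proof (rule field_differentiable_bound[OF convex_UNIV])
      show "((\<lambda>w. w * stein_solution h w) has_real_derivative
          (1 + w\<^sup>2) * stein_solution h w + w * (h w - ?m)) (at w)" for w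
        by (rule DERIV_cong[OF DERIV_mult[OF DERIV_ident stein_solution_has_real_derivative[OF h]]])
          (simp add: algebra_simps power2_eq_square)
    qed (use stein_solution_bound[OF h] in auto)
    then show "dist (x * stein_solution h x) (y * stein_solution h y) \<le> K * dist x y"
      by (simp add: dist_norm)
  qed (rule lipschitz_on_nonneg[OF h])
  then have "(K + (K + 0))-lipschitz_on UNIV (\<lambda>w. w * stein_solution h w + (h w - ?m))"
    by (rule lipschitz_on_add[OF _ lipschitz_on_diff[OF h lipschitz_on_constant]])
  then show "(2 * K)-lipschitz_on UNIV (\<lambda>w. w * stein_solution h w + (h w - ?m))" by simp
qed

section \<open>The L1 distance of distribution functions\<close>

lemma indicator_atLeast_diff:
  fixes y z :: real
  shows "integrable lborel (\<lambda>x. indicator {z..} x - indicator {y..} x :: real)"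
    "(LBINT x. \<bar>indicator {z..} x - indicator {y..} x :: real\<bar>) = \<bar>y - z\<bar>"
proof -
  have abs: "\<bar>indicator {z..} x - indicator {y..} x :: real\<bar> = indicator {min y z..<max y z} x"
    for x
    by (auto simp: indicator_def min_def max_def)
  have "integrable lborel (indicator {min y z..<max y z} :: real \<Rightarrow> real)" by simp
  then show "integrable lborel (\<lambda>x. indicator {z..} x - indicator {y..} x :: real)"
    by (rule Bochner_Integration.integrable_bound) (auto simp: abs)
  show "(LBINT x. \<bar>indicator {z..} x - indicator {y..} x :: real\<bar>) = \<bar>y - z\<bar>"
    unfolding abs by (auto simp: min_def max_def)
qed

lemma bounded_mult_indicator_atLeast_diff:
  fixes u :: "real \<Rightarrow> real"
  assumes [measurable]: "u \<in> borel_measurable borel" and u: "\<And>x. \<bar>u x\<bar> \<le> K"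
  shows "integrable lborel (\<lambda>x. u x * (indicator {z..} x - indicator {y..} x))"
    "(LBINT x. \<bar>u x * (indicator {z..} x - indicator {y..} x)\<bar>) \<le> K * \<bar>y - z\<bar>"
proof -
  note diff = indicator_atLeast_diff[of z y]
  have bound: "\<bar>u x * (indicator {z..} x - indicator {y..} x)\<bar>
      \<le> K * \<bar>indicator {z..} x - indicator {y..} x\<bar>" for x
    unfolding abs_mult by (intro mult_right_mono u) auto
  have "integrable lborel (\<lambda>x. K * \<bar>indicator {z..} x - indicator {y..} x\<bar>)"
    using diff(1) by auto
  then show product: "integrable lborel (\<lambda>x. u x * (indicator {z..} x - indicator {y..} x))"
    by (rule Bochner_Integration.integrable_bound)
      (auto simp del: abs_mult intro!: AE_I2 order_trans[OF bound abs_ge_self])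
  have "(LBINT x. \<bar>u x * (indicator {z..} x - indicator {y..} x)\<bar>)
      \<le> (LBINT x. K * \<bar>indicator {z..} x - indicator {y..} x\<bar>)"
    using diff(1) by (intro integral_mono bound integrable_abs product) auto
  then show "(LBINT x. \<bar>u x * (indicator {z..} x - indicator {y..} x)\<bar>) \<le> K * \<bar>y - z\<bar>"
    using diff(2) by simp
qed

text \<open>The integral of \<^term>\<open>u\<close> from \<^term>\<open>0\<close> to \<^term>\<open>y\<close>, in a form suited to Fubini's theorem and
  valid for both signs of \<^term>\<open>y\<close>.\<close>

definition primitive :: "(real \<Rightarrow> real) \<Rightarrow> real \<Rightarrow> real" where
  "primitive u y = (LBINT x. u x * (indicator {0..} x - indicator {y..} x))"

lemma lipschitz_on_primitive:
  fixes u :: "real \<Rightarrow> real"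
  assumes measurable: "u \<in> borel_measurable borel" and u: "\<And>x. \<bar>u x\<bar> \<le> K"
  shows "K-lipschitz_on UNIV (primitive u)"
proof (rule lipschitz_onI)
  note product = bounded_mult_indicator_atLeast_diff[OF measurable u]
  fix y z :: real
  have "primitive u y - primitive u z
      = (LBINT x. u x * (indicator {0..} x - indicator {y..} x)
          - u x * (indicator {0..} x - indicator {z..} x))"
    unfolding primitive_def by (intro Bochner_Integration.integral_diff[symmetric] product(1))
  also have "\<dots> = (LBINT x. u x * (indicator {z..} x - indicator {y..} x))"
    by (simp add: right_diff_distrib)
  finally have "\<bar>primitive u y - primitive u z\<bar>
      \<le> (LBINT x. \<bar>u x * (indicator {z..} x - indicator {y..} x)\<bar>)"
    by simp
  also have "\<dots> \<le> K * \<bar>y - z\<bar>" by (rule product(2))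
  finally show "dist (primitive u y) (primitive u z) \<le> K * dist y z" by (simp add: dist_real_def)
qed (rule order_trans[OF abs_ge_zero u[of 0]])

lemma (in real_distribution) expectation_primitive:
  fixes u :: "real \<Rightarrow> real"
  assumes ident: "integrable M (\<lambda>x. x)"
    and measurable [measurable]: "u \<in> borel_measurable borel" and u: "\<And>x. \<bar>u x\<bar> \<le> K"
  shows "integrable lborel (\<lambda>x. u x * (indicator {0..} x - cdf M x))"
    "expectation (primitive u) = (LBINT x. u x * (indicator {0..} x - cdf M x))"
proof -
  interpret product: pair_sigma_finite M lborel
    by (simp add: pair_sigma_finite_def sigma_finite_measure_axioms sigma_finite_lborel)
  define q where "q y x = u x * (indicator {0..} x - indicator {y..} x)" for y x
  have indicator: "indicator {y..} x = (if y \<le> x then 1 else 0 :: real)" for x y :: real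
    by (simp add: indicator_def)
  have "case_prod q \<in> borel_measurable (borel \<Otimes>\<^sub>M borel)"
    unfolding q_def indicator by measurable
  then have [measurable]: "case_prod q \<in> borel_measurable (M \<Otimes>\<^sub>M lborel)"
    by (simp cong: measurable_cong_sets sets_pair_measure_cong)
  have q: "integrable lborel (q y)" "(LBINT x. \<bar>q y x\<bar>) \<le> K * \<bar>y\<bar>" for y
    using bounded_mult_indicator_atLeast_diff[OF measurable u, of 0 y] by (simp_all add: q_def[abs_def])
  have integrable_q: "integrable (M \<Otimes>\<^sub>M lborel) (case_prod q)"
  proof (rule product.Fubini_integrable)
    show "integrable M (\<lambda>y. LBINT x. norm (case_prod q (y, x)))"
    proof (rule Bochner_Integration.integrable_bound)
      show "integrable M (\<lambda>y. K * \<bar>y\<bar>)" using ident by simp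
      show "AE y in M. norm (LBINT x. norm (case_prod q (y, x))) \<le> norm (K * \<bar>y\<bar>)"
        using q(2) by (auto intro!: AE_I2 order_trans[OF _ abs_ge_self] simp del: abs_mult)
    qed measurable
  qed (use q(1) in auto)
  have cdf: "(\<integral>y. q y x \<partial>M) = u x * (indicator {0..} x - cdf M x)" for x
  proof -
    have "(\<integral>y. q y x \<partial>M) = (\<integral>y. u x * (indicator {0..} x - indicator {..x} y) \<partial>M)"
      unfolding q_def by (intro Bochner_Integration.integral_cong) (auto simp: indicator_def)
    also have "\<dots> = u x * (indicator {0..} x - cdf M x)"
      using prob_space by (simp add: cdf_def emeasure_eq_measure)
    finally show ?thesis .
  qed
  show "integrable lborel (\<lambda>x. u x * (indicator {0..} x - cdf M x))"
    using product.integrable_snd[OF integrable_q] by (simp add: cdf)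
  show "expectation (primitive u) = (LBINT x. u x * (indicator {0..} x - cdf M x))"
    using product.Fubini_integral[OF integrable_q]
    by (simp add: cdf) (simp add: q_def primitive_def[abs_def])
qed

lemma L1_dist_cdf_le:
  assumes \<mu>: "real_distribution \<mu>" "integrable \<mu> (\<lambda>x. x)"
    and \<nu>: "real_distribution \<nu>" "integrable \<nu> (\<lambda>x. x)"
    and le: "\<And>h. 1-lipschitz_on UNIV h \<Longrightarrow> (\<integral>x. h x \<partial>\<mu>) - (\<integral>x. h x \<partial>\<nu>) \<le> C"
  shows "L1_dist (cdf \<mu>) (cdf \<nu>) \<le> ennreal C"
proof -
  interpret \<mu>: real_distribution \<mu> by fact
  interpret \<nu>: real_distribution \<nu> by fact
  define u where "u x = sgn (cdf \<nu> x - cdf \<mu> x)" for x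
  have [measurable]: "cdf \<mu> \<in> borel_measurable borel" "cdf \<nu> \<in> borel_measurable borel"
    by (auto intro!: borel_measurable_mono monoI \<mu>.cdf_nondecreasing \<nu>.cdf_nondecreasing)
  have u: "u \<in> borel_measurable borel" unfolding u_def by measurable
  have u_le: "\<bar>u x\<bar> \<le> 1" for x by (simp add: u_def sgn_if)
  note expectations = \<mu>.expectation_primitive[OF \<mu>(2) u u_le] \<nu>.expectation_primitive[OF \<nu>(2) u u_le]
  have abs: "\<bar>cdf \<mu> x - cdf \<nu> x\<bar>
      = u x * (indicator {0..} x - cdf \<mu> x) - u x * (indicator {0..} x - cdf \<nu> x)" for x
    by (auto simp: u_def sgn_if)
  have "integrable lborel (\<lambda>x. \<bar>cdf \<mu> x - cdf \<nu> x\<bar>)"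
    unfolding abs using expectations by auto
  then have "L1_dist (cdf \<mu>) (cdf \<nu>) = ennreal (LBINT x. \<bar>cdf \<mu> x - cdf \<nu> x\<bar>)"
    unfolding L1_dist_def by (intro nn_integral_eq_integral) auto
  also have "(LBINT x. \<bar>cdf \<mu> x - cdf \<nu> x\<bar>) = (\<integral>x. primitive u x \<partial>\<mu>) - (\<integral>x. primitive u x \<partial>\<nu>)"
    unfolding abs using expectations by simp
  also have "\<dots> \<le> C" by (intro le lipschitz_on_primitive u u_le)
  finally show ?thesis by (simp add: ennreal_leI)
qed

section \<open>Normal approximation of sums\<close>

lemma (in prob_space) expectation_lipschitz_sum_diff_le:
  fixes X :: "'i \<Rightarrow> 'a \<Rightarrow> real"
  assumes h: "K-lipschitz_on UNIV h"
    and I: "finite I" and indep: "indep_vars (\<lambda>_. borel) X I"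
    and cubes: "\<And>i. i \<in> I \<Longrightarrow> integrable M (\<lambda>\<omega>. \<bar>X i \<omega>\<bar> ^ 3)"
    and mean: "\<And>i. i \<in> I \<Longrightarrow> expectation (X i) = 0"
    and variance: "(\<Sum>i\<in>I. expectation (\<lambda>\<omega>. (X i \<omega>)\<^sup>2)) = 1"
  defines "W \<equiv> \<lambda>\<omega>. \<Sum>i\<in>I. X i \<omega>"
  shows "expectation (\<lambda>\<omega>. h (W \<omega>)) - std_normal.expectation h
    \<le> K * (\<Sum>i\<in>I. expectation (\<lambda>\<omega>. \<bar>X i \<omega>\<bar> ^ 3))"
proof -
  define g g' where "g = stein_solution h"
    and "g' = (\<lambda>w. w * g w + (h w - std_normal.expectation h))"
  have g: "lipschitz_derivative g g' (2 * K)"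
    unfolding g'_def g_def by (rule stein_solution_lipschitz_derivative[OF h])
  have W: "W \<in> borel_measurable M"
    unfolding W_def using indep_vars_rv[OF indep] by (intro borel_measurable_sum)
  have W_cube: "integrable M (\<lambda>\<omega>. \<bar>W \<omega>\<bar> ^ 3)"
    unfolding W_def using I indep_vars_rv[OF indep] cubes by (intro integrable_abs_sum_power)
  have "integrable M (\<lambda>\<omega>. h (W \<omega>))"
    using integrable_lipschitz[OF h] integrable_power_le[OF W W_cube, of 1] by simp
  then have "expectation (\<lambda>\<omega>. h (W \<omega>)) - std_normal.expectation h
      = expectation (\<lambda>\<omega>. g' (W \<omega>) - W \<omega> * g (W \<omega>))"
    by (simp add: g'_def prob_space)
  also have "\<dots> = 1 * expectation (\<lambda>\<omega>. g' (W \<omega>)) - expectation (\<lambda>\<omega>. W \<omega> * g (W \<omega>))"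
    using integrable_lipschitz_derivative(2)[OF g W W_cube]
      integrable_mult_lipschitz_derivative(1)[OF g W W W_cube W_cube] by simp
  also have "\<dots> \<le> K * (\<Sum>i\<in>I. expectation (\<lambda>\<omega>. \<bar>X i \<omega>\<bar> ^ 3))"
    using stein_bound_sum[OF g I indep cubes mean] by (simp add: variance W_def)
  finally show ?thesis .
qed

lemma (in prob_space) L1_dist_sum_std_normal:
  fixes X :: "'i \<Rightarrow> 'a \<Rightarrow> real"
  assumes I: "finite I" and indep: "indep_vars (\<lambda>_. borel) X I"
    and cubes: "\<And>i. i \<in> I \<Longrightarrow> integrable M (\<lambda>\<omega>. \<bar>X i \<omega>\<bar> ^ 3)"
    and mean: "\<And>i. i \<in> I \<Longrightarrow> expectation (X i) = 0"
    and variance: "(\<Sum>i\<in>I. expectation (\<lambda>\<omega>. (X i \<omega>)\<^sup>2)) = 1"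
  shows "L1_dist (cdf (distr M borel (\<lambda>\<omega>. \<Sum>i\<in>I. X i \<omega>))) (cdf std_normal_distribution)
    \<le> ennreal (\<Sum>i\<in>I. expectation (\<lambda>\<omega>. \<bar>X i \<omega>\<bar> ^ 3))"
proof (rule L1_dist_cdf_le)
  have [measurable]: "(\<lambda>\<omega>. \<Sum>i\<in>I. X i \<omega>) \<in> borel_measurable M"
    using indep_vars_rv[OF indep] by (intro borel_measurable_sum)
  show "real_distribution (distr M borel (\<lambda>\<omega>. \<Sum>i\<in>I. X i \<omega>))" by simp
  have "integrable M (X i)" if "i \<in> I" for i
    using integrable_power_le[OF indep_vars_rv[OF indep that] cubes[OF that], of 1] by simp
  then show "integrable (distr M borel (\<lambda>\<omega>. \<Sum>i\<in>I. X i \<omega>)) (\<lambda>x. x)"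
    by (simp add: integrable_distr_eq)
  show "real_distribution std_normal_distribution" by (rule real_dist_normal_dist)
  show "integrable std_normal_distribution (\<lambda>x. x)" by simp
  fix h :: "real \<Rightarrow> real"
  assume h: "1-lipschitz_on UNIV h"
  then have "h \<in> borel_measurable borel" by (rule borel_measurable_lipschitz)
  then show "(\<integral>x. h x \<partial>distr M borel (\<lambda>\<omega>. \<Sum>i\<in>I. X i \<omega>)) - std_normal.expectation h
      \<le> (\<Sum>i\<in>I. expectation (\<lambda>\<omega>. \<bar>X i \<omega>\<bar> ^ 3))"
    using expectation_lipschitz_sum_diff_le[OF h I indep cubes mean variance]
    by (simp add: integral_distr)
qed

lemma (in prob_space) mean_zero_class_moments:
  fixes X :: "'a \<Rightarrow> real"
  assumes "X \<in> borel_measurable M" "distr M borel X \<in> mean_zero_class s"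
  shows "integrable M (\<lambda>\<omega>. \<bar>X \<omega>\<bar> ^ 3)" "expectation X = 0" "expectation (\<lambda>\<omega>. (X \<omega>)\<^sup>2) = s\<^sup>2"
  using assms by (auto simp: mean_zero_class_def integrable_distr_eq integral_distr)

lemma (in prob_space) L1_dist_normalized_sum:
  fixes X :: "'i \<Rightarrow> 'a \<Rightarrow> real"
  assumes I: "finite I" and indep: "indep_vars (\<lambda>_. borel) X I"
    and X: "\<And>i. i \<in> I \<Longrightarrow> distr M borel (X i) \<in> mean_zero_class (s i)"
    and \<sigma>: "\<sigma> > 0" "\<sigma>\<^sup>2 = (\<Sum>i\<in>I. (s i)\<^sup>2)"
  shows "L1_dist (cdf (distr M borel (\<lambda>\<omega>. 1 / \<sigma> * (\<Sum>i\<in>I. X i \<omega>)))) (cdf std_normal_distribution)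
    \<le> ennreal (1 / \<sigma> ^ 3 * (\<Sum>i\<in>I. expectation (\<lambda>\<omega>. \<bar>X i \<omega>\<bar> ^ 3)))"
proof -
  note moments = mean_zero_class_moments[OF indep_vars_rv[OF indep] X]
  define Y where "Y i \<omega> = 1 / \<sigma> * X i \<omega>" for i \<omega>
  have cube: "\<bar>Y i \<omega>\<bar> ^ 3 = 1 / \<sigma> ^ 3 * \<bar>X i \<omega>\<bar> ^ 3" for i \<omega>
    using \<sigma>(1) by (simp add: Y_def abs_mult power_divide)
  have square: "(Y i \<omega>)\<^sup>2 = 1 / \<sigma>\<^sup>2 * (X i \<omega>)\<^sup>2" for i \<omega>
    by (simp add: Y_def power_divide)
  have "L1_dist (cdf (distr M borel (\<lambda>\<omega>. \<Sum>i\<in>I. Y i \<omega>))) (cdf std_normal_distribution)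
      \<le> ennreal (\<Sum>i\<in>I. expectation (\<lambda>\<omega>. \<bar>Y i \<omega>\<bar> ^ 3))"
  proof (rule L1_dist_sum_std_normal[OF I])
    show "indep_vars (\<lambda>_. borel) Y I"
      unfolding Y_def[abs_def] using indep_vars_compose2[OF indep, of "\<lambda>_ x. 1 / \<sigma> * x"] by simp
    show "integrable M (\<lambda>\<omega>. \<bar>Y i \<omega>\<bar> ^ 3)" if "i \<in> I" for i
      unfolding cube using moments(1)[OF that that] by simp
    show "expectation (Y i) = 0" if "i \<in> I" for i
      unfolding Y_def[abs_def] using moments(2)[OF that that] by simp
    have "(\<Sum>i\<in>I. expectation (\<lambda>\<omega>. (Y i \<omega>)\<^sup>2)) = 1 / \<sigma>\<^sup>2 * (\<Sum>i\<in>I. (s i)\<^sup>2)"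
      unfolding square sum_distrib_left using moments(3) by (intro sum.cong) simp_all
    then show "(\<Sum>i\<in>I. expectation (\<lambda>\<omega>. (Y i \<omega>)\<^sup>2)) = 1"
      using \<sigma>(1) by (simp flip: \<sigma>(2))
  qed
  then show ?thesis
    unfolding cube by (simp add: Y_def sum_distrib_left)
qed

lemma (in prob_space) L1_dist_normalized_iid_sum:
  fixes X :: "'i \<Rightarrow> 'a \<Rightarrow> real"
  assumes I: "finite I" "I \<noteq> {}" and indep: "indep_vars (\<lambda>_. borel) X I"
    and G: "G \<in> mean_zero_class \<sigma>" and X: "\<And>i. i \<in> I \<Longrightarrow> distr M borel (X i) = G"
    and \<sigma>: "\<sigma> > 0"
  shows "L1_dist (cdf (distr M borel (\<lambda>\<omega>. (\<Sum>i\<in>I. X i \<omega>) / (\<sigma> * sqrt (card I)))))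
      (cdf std_normal_distribution)
    \<le> ennreal ((\<integral>x. \<bar>x\<bar> ^ 3 \<partial>G) / (\<sigma> ^ 3 * sqrt (card I)))"
proof -
  have card: "0 < card I" using I by (simp add: card_gt_0_iff)
  have "expectation (\<lambda>\<omega>. \<bar>X i \<omega>\<bar> ^ 3) = (\<integral>x. \<bar>x\<bar> ^ 3 \<partial>G)" if "i \<in> I" for i
    unfolding X[OF that, symmetric] using indep_vars_rv[OF indep that]
    by (subst integral_distr) auto
  then have "(\<Sum>i\<in>I. expectation (\<lambda>\<omega>. \<bar>X i \<omega>\<bar> ^ 3)) = card I * (\<integral>x. \<bar>x\<bar> ^ 3 \<partial>G)"
    by simp
  moreover have "sqrt (card I) ^ 3 = card I * sqrt (card I)"
    by (simp add: power3_eq_cube)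
  ultimately have "1 / (\<sigma> * sqrt (card I)) ^ 3 * (\<Sum>i\<in>I. expectation (\<lambda>\<omega>. \<bar>X i \<omega>\<bar> ^ 3))
      = (\<integral>x. \<bar>x\<bar> ^ 3 \<partial>G) / (\<sigma> ^ 3 * sqrt (card I))"
    using card by (simp add: power_mult_distrib field_simps)
  moreover have "L1_dist (cdf (distr M borel (\<lambda>\<omega>. 1 / (\<sigma> * sqrt (card I)) * (\<Sum>i\<in>I. X i \<omega>))))
        (cdf std_normal_distribution)
      \<le> ennreal (1 / (\<sigma> * sqrt (card I)) ^ 3 * (\<Sum>i\<in>I. expectation (\<lambda>\<omega>. \<bar>X i \<omega>\<bar> ^ 3)))"
    using X G \<sigma> card
    by (intro L1_dist_normalized_sum[OF I(1) indep, where s="\<lambda>_. \<sigma>"])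
      (auto simp: power_mult_distrib)
  ultimately show ?thesis by simp
qed

theorem theorem1p1:
  fixes M :: "'a measure"
  assumes "prob_space M"
  shows
    "(\<forall>(n::nat) (X :: nat \<Rightarrow> 'a \<Rightarrow> real) (G :: nat \<Rightarrow> real measure) (s :: nat \<Rightarrow> real) (\<sigma>::real).
        n \<ge> 1 \<longrightarrow>
        prob_space.indep_vars M (\<lambda>_. borel) X {1..n} \<longrightarrow>
        (\<forall>i\<in>{1..n}. s i > 0 \<and> G i \<in> mean_zero_class (s i) \<and> distr M borel (X i) = G i) \<longrightarrow>
        \<sigma> > 0 \<longrightarrow> \<sigma>\<^sup>2 = (\<Sum>i=1..n. (s i)\<^sup>2) \<longrightarrow>
        L1_dist (cdf (distr M borel (\<lambda>\<omega>. 1 / \<sigma> * (\<Sum>i=1..n. X i \<omega>)))) (cdf std_normal_distribution)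
          \<le> ennreal (1 / \<sigma> ^ 3 * (\<Sum>i=1..n. prob_space.expectation M (\<lambda>\<omega>. \<bar>X i \<omega>\<bar> ^ 3))))
     \<and>
     (\<forall>(X :: nat \<Rightarrow> 'a \<Rightarrow> real) (G :: real measure) (\<sigma>::real).
        prob_space.indep_vars M (\<lambda>_. borel) X {1..} \<longrightarrow>
        \<sigma> > 0 \<longrightarrow> G \<in> mean_zero_class \<sigma> \<longrightarrow>
        (\<forall>i\<ge>1. distr M borel (X i) = G) \<longrightarrow>
        (\<forall>n::nat. n \<ge> 1 \<longrightarrow>
          L1_dist (cdf (distr M borel (\<lambda>\<omega>. (\<Sum>i=1..n. X i \<omega>) / (\<sigma> * sqrt (real n)))))
                  (cdf std_normal_distribution)
            \<le> ennreal (prob_space.expectation M (\<lambda>\<omega>. \<bar>X 1 \<omega>\<bar> ^ 3) / (\<sigma> ^ 3 * sqrt (real n)))))"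
proof -
  interpret prob_space M by fact
  show ?thesis
  proof (intro conjI allI impI)
    fix n :: nat and X :: "nat \<Rightarrow> 'a \<Rightarrow> real" and G :: "nat \<Rightarrow> real measure"
      and s :: "nat \<Rightarrow> real" and \<sigma> :: real
    assume "indep_vars (\<lambda>_. borel) X {1..n}" "\<sigma> > 0" "\<sigma>\<^sup>2 = (\<Sum>i=1..n. (s i)\<^sup>2)"
      "\<forall>i\<in>{1..n}. s i > 0 \<and> G i \<in> mean_zero_class (s i) \<and> distr M borel (X i) = G i"
    then show "L1_dist (cdf (distr M borel (\<lambda>\<omega>. 1 / \<sigma> * (\<Sum>i=1..n. X i \<omega>))))
          (cdf std_normal_distribution)
        \<le> ennreal (1 / \<sigma> ^ 3 * (\<Sum>i=1..n. expectation (\<lambda>\<omega>. \<bar>X i \<omega>\<bar> ^ 3)))"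
      by (intro L1_dist_normalized_sum[where s=s]) auto
  next
    fix X :: "nat \<Rightarrow> 'a \<Rightarrow> real" and G :: "real measure" and \<sigma> :: real and n :: nat
    assume indep: "indep_vars (\<lambda>_. borel) X {1..}" and "\<sigma> > 0" "G \<in> mean_zero_class \<sigma>" "n \<ge> 1"
      and X: "\<forall>i\<ge>1. distr M borel (X i) = G"
    moreover have "(\<integral>x. \<bar>x\<bar> ^ 3 \<partial>G) = expectation (\<lambda>\<omega>. \<bar>X 1 \<omega>\<bar> ^ 3)"
      using X indep_vars_rv[OF indep] by (subst integral_distr[symmetric]) auto
    ultimately show "L1_dist (cdf (distr M borel (\<lambda>\<omega>. (\<Sum>i=1..n. X i \<omega>) / (\<sigma> * sqrt (real n)))))
        (cdf std_normal_distribution)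
        \<le> ennreal (expectation (\<lambda>\<omega>. \<bar>X 1 \<omega>\<bar> ^ 3) / (\<sigma> ^ 3 * sqrt (real n)))"
      using L1_dist_normalized_iid_sum[of "{1..n}" X G \<sigma>] indep_vars_subset[OF indep, of "{1..n}"]
      by auto
  qed
qed

end
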